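(* For all integers $m\ge 0$ and $n\ge 1$, writing $U_k=T_{k}^{(s_{1,0}^{(n)},s_{1,1}^{(n)},s_{1,2}^{(n)})}$ and $V^{(j)}_k=T_{k}^{(s_{1,0}^{(jn)},s_{1,1}^{(jn)},s_{1,2}^{(jn)})}$ for $j=2,3,4,5$, \begin{align*} &\frac{1}{(A_1^{(n)})^5}\sum_{\substack{k_1+\cdots+k_5=m\\ k_1,\dots,k_5\ge 0}}\binom{m}{k_1,\dots,k_5}U_{k_1}\cdots U_{k_5}\\ &=-\frac{14\cdot 5^m}{A_1^{(5n)}}V^{(5)}_m +\frac{5}{44^n A_1^{(2n)}}\sum_{k=0}^m\binom{m}{k}2^{k}V^{(2)}_k +\frac{15}{44^n(A_1^{(n)})^2}\sum_{\substack{k_1+k_2+k_3=m\\ k_1,k_2,k_3\ge0}}\binom{m}{k_1,k_2,k_3}U_{k_1}U_{k_2}\\ &\quad +\frac{5}{A_1^{(4n)} A_1^{(n)}}\sum_{k=0}^m\binom{m}{k}4^{k}V^{(4)}_k U_{m-k} +\frac{10}{A_1^{(3n)} A_1^{(2n)}}\sum_{k=0}^m\binom{m}{k}3^{k}2^{m-k}V^{(3)}_kV^{(2)}_{m-k}. \end{align*}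
   Context: Let $\alpha,\beta,\gamma$ be the three distinct complex roots of $x^3-x^2-x-1=0$, and set $c_1=\frac{\alpha}{(\alpha-\beta)(\alpha-\gamma)}$, $c_2=\frac{\beta}{(\beta-\alpha)(\beta-\gamma)}$, $c_3=\frac{\gamma}{(\gamma-\alpha)(\gamma-\beta)}$. For numbers $s_0,s_1,s_2$, the sequence $T_k^{(s_0,s_1,s_2)}$ is defined by $T_0^{(s_0,s_1,s_2)}=s_0$, $T_1^{(s_0,s_1,s_2)}=s_1$, $T_2^{(s_0,s_1,s_2)}=s_2$ and $T_k^{(s_0,s_1,s_2)}=T_{k-1}^{(s_0,s_1,s_2)}+T_{k-2}^{(s_0,s_1,s_2)}+T_{k-3}^{(s_0,s_1,s_2)}$ for $k\ge3$. For each integer $N\ge1$, let $A_1^{(N)}\neq0$ and $s_{1,0}^{(N)},s_{1,1}^{(N)},s_{1,2}^{(N)}$ be numbers such that $c_1^Ne^{\alpha x}+c_2^Ne^{\beta x}+c_3^Ne^{\gamma x}=\frac{1}{A_1^{(N)}}\sum_{k\ge0}T_k^{(s_{1,0}^{(N)},s_{1,1}^{(N)},s_{1,2}^{(N)})}\frac{x^k}{k!}$ (in the paper these are specific integer normalizations). $\binom{m}{k_1,\dots,k_r}=\frac{m!}{k_1!\cdots k_r!}$ is the multinomial coefficient. *)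

theory Defs
  imports Complex_Main
begin

fun T :: "complex \<Rightarrow> complex \<Rightarrow> complex \<Rightarrow> nat \<Rightarrow> complex" where
  "T s0 s1 s2 0 = s0"
| "T s0 s1 s2 (Suc 0) = s1"
| "T s0 s1 s2 (Suc (Suc 0)) = s2"
| "T s0 s1 s2 (Suc (Suc (Suc k))) =
     T s0 s1 s2 (Suc (Suc k)) + T s0 s1 s2 (Suc k) + T s0 s1 s2 k"

definition multinomial :: "nat \<Rightarrow> nat list \<Rightarrow> complex" where
  "multinomial m ks = fact m / (\<Prod>k\<leftarrow>ks. fact k)"

lemma T_bound: "norm (T s0 s1 s2 k) \<le> (norm s0 + norm s1 + norm s2) * 3 ^ k"
proof (induction s0 s1 s2 k rule: T.induct)
  case (2 s0 s1 s2)
  then show ?case by (simp add: algebra_simps add_increasing add_increasing2)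
next
  case (3 s0 s1 s2)
  have "norm s2 \<le> norm s0 + norm s1 + norm s2"
    by simp
  also have "\<dots> \<le> (norm s0 + norm s1 + norm s2) * 3 ^ 2"
    by simp
  finally show ?case by (simp add: numeral_2_eq_2)
next
  case (4 s0 s1 s2 k)
  define C where "C = norm s0 + norm s1 + norm s2"
  have C: "0 \<le> C * 3 ^ k" by (simp add: C_def)
  have "norm (T s0 s1 s2 (Suc (Suc (Suc k)))) \<le>
      norm (T s0 s1 s2 (Suc (Suc k))) + norm (T s0 s1 s2 (Suc k)) + norm (T s0 s1 s2 k)"
    by (simp add: norm_triangle_le)
  also have "\<dots> \<le> C * 3 ^ Suc (Suc k) + C * 3 ^ Suc k + C * 3 ^ k"
    using "4.IH" unfolding C_def by (intro add_mono) auto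
  also have "\<dots> = 13 * (C * 3 ^ k)" by simp
  also have "\<dots> \<le> 27 * (C * 3 ^ k)" using C by linarith
  also have "\<dots> = C * 3 ^ Suc (Suc (Suc k))" by simp
  finally show ?case unfolding C_def .
qed simp

text \<open>The exponential generating series of the sequence converges everywhere, so an infinite sum
  over it always has its usual meaning.\<close>

lemma summable_T_egf: "summable (\<lambda>k. T s0 s1 s2 k * x ^ k / fact k)"
proof (rule summable_comparison_test')
  show "summable (\<lambda>k. (norm s0 + norm s1 + norm s2) * ((3 * norm x) ^ k /\<^sub>R fact k))"
    by (intro summable_mult summable_exp_generic)
  fix k :: nat
  have "norm (T s0 s1 s2 k) * (norm x ^ k / fact k)
      \<le> (norm s0 + norm s1 + norm s2) * 3 ^ k * (norm x ^ k / fact k)"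
    by (intro mult_right_mono T_bound) simp
  then show "norm (T s0 s1 s2 k * x ^ k / fact k)
      \<le> (norm s0 + norm s1 + norm s2) * ((3 * norm x) ^ k /\<^sub>R fact k)"
    by (simp add: norm_mult norm_divide norm_power power_mult_distrib field_simps)
qed

end

theory Submission
  imports Defs "HOL-Analysis.FPS_Convergence"
begin

unbundle fps_syntax
unbundle no vec_syntax

text \<open>With \<open>a, b, c\<close> the three summands of the generating function for \<open>N = n\<close>, the power sums
  \<open>p_j = a^j + b^j + c^j\<close> are the generating functions for \<open>N = j n\<close> with \<open>x\<close> replaced by \<open>j x\<close>, and
  \<open>a b c = e^x / 44^n\<close> because the cubic has root sum 1 and discriminant -44.
  The theorem is the coefficient of \<open>x^m / m!\<close> in
  \<open>p_1^5 = -14 p_5 + 5 a b c p_2 + 15 a b c p_1^2 + 5 p_4 p_1 + 10 p_3 p_2\<close>.\<close>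

lemma power_sum_identity:
  fixes a b c :: "'a::idom"
  shows "(a + b + c) ^ 5 = - (14 * (a ^ 5 + b ^ 5 + c ^ 5)) + 5 * (a * b * c * (a\<^sup>2 + b\<^sup>2 + c\<^sup>2))
    + 15 * (a * b * c * (a + b + c)\<^sup>2) + 5 * ((a ^ 4 + b ^ 4 + c ^ 4) * (a + b + c))
    + 10 * ((a ^ 3 + b ^ 3 + c ^ 3) * (a\<^sup>2 + b\<^sup>2 + c\<^sup>2))"
  by algebra

text \<open>Subtracting two root equations and cancelling the difference of the roots lowers the
  degree by one; doing this twice leaves a linear relation. Only cancellation in an integral domain
  is used, with no factorisation of the cubic.\<close>

lemma tribonacci_vieta:
  fixes a b c :: "'a::idom"
  assumes "a ^ 3 - a ^ 2 - a - 1 = 0" "b ^ 3 - b ^ 2 - b - 1 = 0" "c ^ 3 - c ^ 2 - c - 1 = 0"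
    and "a \<noteq> b" "a \<noteq> c" "b \<noteq> c"
  shows "a + b + c = 1" "a * b + a * c + b * c = - 1" "a * b * c = 1"
proof -
  have ab: "a\<^sup>2 + a * b + b\<^sup>2 - a - b - 1 = 0"
  proof -
    have "(a - b) * (a\<^sup>2 + a * b + b\<^sup>2 - a - b - 1) = 0"
      using assms(1,2) by algebra
    with assms(4) show ?thesis by simp
  qed
  have ac: "a\<^sup>2 + a * c + c\<^sup>2 - a - c - 1 = 0"
  proof -
    have "(a - c) * (a\<^sup>2 + a * c + c\<^sup>2 - a - c - 1) = 0"
      using assms(1,3) by algebra
    with assms(5) show ?thesis by simp
  qed
  \<comment> \<open>The left side is exactly the difference of the relations \<open>ab\<close> and
    \<open>ac\<close>.\<close>
  have "(b - c) * (a + b + c - 1) = 0"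
    using ab ac by algebra
  with assms(6) show e1: "a + b + c = 1" by simp
  show e2: "a * b + a * c + b * c = - 1"
    using ab e1 by algebra
  \<comment> \<open>With the first two symmetric functions known, \<open>a\<close> is a root of
    \<open>x^3 - x^2 - x - a * b * c\<close>; comparison with the cubic gives the third.\<close>
  show "a * b * c = 1"
    using assms(1) e1 e2 by algebra
qed

text \<open>The six factors form three pairs of opposite sign, so the product is minus the
  discriminant. They are grouped as the denominators of \<open>c1\<close>, \<open>c2\<close>,
  \<open>c3\<close>.\<close>

lemma tribonacci_discriminant:
  fixes a b c :: "'a::idom"
  assumes "a + b + c = 1" "a * b + a * c + b * c = - 1" "a * b * c = 1"
  shows "(a - b) * (a - c) * ((b - a) * (b - c)) * ((c - a) * (c - b)) = 44"
  using assms by algebra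

definition exp_gf :: "(nat \<Rightarrow> 'a::field_char_0) \<Rightarrow> 'a fps" where
  "exp_gf f = Abs_fps (\<lambda>k. f k / fact k)"

lemma exp_gf_nth [simp]: "exp_gf f $ k = f k / fact k"
  by (simp add: exp_gf_def)

lemma exp_gf_one: "exp_gf (\<lambda>_. 1) = fps_exp 1"
  by (simp add: fps_eq_iff)

lemma exp_gf_mult_nth:
  "(exp_gf f * exp_gf g) $ m = (\<Sum>k = 0..m. of_nat (m choose k) * f k * g (m - k)) / fact m"
  unfolding fps_mult_nth sum_divide_distrib
  by (intro sum.cong refl) (simp add: binomial_fact)

text \<open>Passes from a product of r factors to r + 1 factors: \<open>t\<close> stands for the
  tuple of the r old indices and \<open>s t\<close> for their sum. Since the tuple type changes with
  r, this step is instantiated once for each length rather than used in an induction.\<close>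

lemma fps_mult_nth_fibre_sum:
  fixes F G :: "'a::semiring_0 fps" and s :: "'b \<Rightarrow> nat"
  assumes "\<And>k. finite {t. s t = k}" and "\<And>k. G $ k = (\<Sum>t | s t = k. g t)"
  shows "(F * G) $ m = (\<Sum>(i, t) | i + s t = m. F $ i * g t)"
proof -
  have "(F * G) $ m = (\<Sum>i = 0..m. \<Sum>t | s t = m - i. F $ i * g t)"
    by (simp add: fps_mult_nth assms(2) sum_distrib_left)
  also have "\<dots> = (\<Sum>(i, t) \<in> (SIGMA i:{0..m}. {t. s t = m - i}). F $ i * g t)"
    using assms(1) by (intro sum.Sigma) auto
  also have "(SIGMA i:{0..m}. {t. s t = m - i}) = {(i, t). i + s t = m}"
    by auto
  finally show ?thesis .
qed

text \<open>Provides the finiteness premise of \<open>fps_mult_nth_fibre_sum\<close> for the next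
  longer tuple.\<close>

lemma finite_fibre_add:
  fixes s :: "'b \<Rightarrow> nat"
  assumes "\<And>k. finite {t. s t = k}"
  shows "finite {(i, t). i + s t = m}"
proof -
  have "{(i, t). i + s t = m} = (SIGMA i:{0..m}. {t. s t = m - i})"
    by auto
  then show ?thesis
    using assms by (simp add: finite_SigmaI)
qed

lemma finite_sum2: "finite {(i, j). i + j = (m::nat)}"
  using finite_fibre_add[of "\<lambda>j. j" m] by simp

lemma finite_sum3: "finite {(i, j, k). i + (j + k) = (m::nat)}"
  using finite_fibre_add[of "\<lambda>(j, k). j + k" m] finite_sum2
  by (simp add: case_prod_unfold)

lemma finite_sum4: "finite {(i, j, k, l). i + (j + (k + l)) = (m::nat)}"
  using finite_fibre_add[of "\<lambda>(j, k, l). j + (k + l)" m] finite_sum3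
  by (simp add: case_prod_unfold)

lemma fps_mult2_nth:
  fixes F G :: "'a::semiring_0 fps"
  shows "(F * G) $ m = (\<Sum>(i, j) | i + j = m. F $ i * G $ j)"
  by (rule fps_mult_nth_fibre_sum) simp_all

lemma fps_mult3_nth:
  fixes F G H :: "'a::semiring_0 fps"
  shows "(F * (G * H)) $ m = (\<Sum>(i, j, k) | i + (j + k) = m. F $ i * (G $ j * H $ k))"
  using fps_mult_nth_fibre_sum[of "\<lambda>(j, k). j + k" "G * H" "\<lambda>(j, k). G $ j * H $ k" F m]
    finite_sum2 fps_mult2_nth[of G H]
  by (simp add: case_prod_unfold)

lemma fps_mult4_nth:
  fixes F G H K :: "'a::semiring_0 fps"
  shows "(F * (G * (H * K))) $ m =
    (\<Sum>(i, j, k, l) | i + (j + (k + l)) = m. F $ i * (G $ j * (H $ k * K $ l)))"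
  using fps_mult_nth_fibre_sum[of "\<lambda>(j, k, l). j + (k + l)" "G * (H * K)"
      "\<lambda>(j, k, l). G $ j * (H $ k * K $ l)" F m]
    finite_sum3 fps_mult3_nth[of G H K]
  by (simp add: case_prod_unfold)

lemma fps_mult5_nth:
  fixes F G H K L :: "'a::semiring_0 fps"
  shows "(F * (G * (H * (K * L)))) $ m =
    (\<Sum>(i, j, k, l, r) | i + (j + (k + (l + r))) = m. F $ i * (G $ j * (H $ k * (K $ l * L $ r))))"
  using fps_mult_nth_fibre_sum[of "\<lambda>(j, k, l, r). j + (k + (l + r))" "G * (H * (K * L))"
      "\<lambda>(j, k, l, r). G $ j * (H $ k * (K $ l * L $ r))" F m]
    finite_sum4 fps_mult4_nth[of G H K L]
  by (simp add: case_prod_unfold)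

lemma exp_gf_power5_nth:
  "(exp_gf u ^ 5) $ m =
    (\<Sum>(k1, k2, k3, k4, k5) \<in> {(k1, k2, k3, k4, k5). k1 + k2 + k3 + k4 + k5 = m}.
      multinomial m [k1, k2, k3, k4, k5] * u k1 * u k2 * u k3 * u k4 * u k5) / fact m"
proof -
  have *: "exp_gf u ^ 5 = exp_gf u * (exp_gf u * (exp_gf u * (exp_gf u * exp_gf u)))"
    by (simp add: eval_nat_numeral)
  show ?thesis
    unfolding * fps_mult5_nth sum_divide_distrib
    by (intro sum.cong) (auto simp: multinomial_def add.assoc)
qed

text \<open>The factor \<open>fps_exp 1\<close> contributes only \<open>1 / fact k3\<close>, so
  \<open>k3\<close> enters the multinomial coefficient but carries no value of
  \<open>u\<close>.\<close>

lemma exp_gf_square_exp_nth: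
  "((exp_gf u)\<^sup>2 * fps_exp 1) $ m =
    (\<Sum>(k1, k2, k3) \<in> {(k1, k2, k3). k1 + k2 + k3 = m}.
      multinomial m [k1, k2, k3] * u k1 * u k2) / fact m"
proof -
  have *: "(exp_gf u)\<^sup>2 * fps_exp 1 = exp_gf u * (exp_gf u * fps_exp 1)"
    by (simp add: power2_eq_square mult.assoc)
  show ?thesis
    unfolding * fps_mult3_nth sum_divide_distrib
    by (intro sum.cong) (auto simp: multinomial_def add.assoc)
qed

lemma has_fps_expansion_T:
  "(\<lambda>x. \<Sum>k. T s0 s1 s2 k * x ^ k / fact k) has_fps_expansion exp_gf (T s0 s1 s2)"
proof -
  \<comment> \<open>Convergence at the single point 1 already gives the positive radius that an
    expansion requires.\<close>
  have "conv_radius (fps_nth (exp_gf (T s0 s1 s2))) \<ge> norm (1::complex)"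
    using summable_T_egf[of s0 s1 s2 1] by (intro conv_radius_geI) simp
  then have "fps_conv_radius (exp_gf (T s0 s1 s2)) > 0"
    unfolding fps_conv_radius_def by (rule less_le_trans[rotated]) simp
  moreover have "eval_fps (exp_gf (T s0 s1 s2)) = (\<lambda>x. \<Sum>k. T s0 s1 s2 k * x ^ k / fact k)"
    by (simp add: eval_fps_def fun_eq_iff)
  ultimately show ?thesis
    by (metis eval_fps_has_fps_expansion)
qed

text \<open>Both sides of \<open>egf\<close> are power series expansions of the same function at 0,
  and such an expansion is unique. This turns the analytic hypothesis into a Binet formula, after
  which all work is formal.\<close>

lemma T_eq_if_egf_eq:
  fixes p q r C1 C2 C3 A :: complex
  assumes "A \<noteq> 0"
    and egf: "\<And>x. C1 * exp (p * x) + C2 * exp (q * x) + C3 * exp (r * x)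
      = 1 / A * (\<Sum>k. T s0 s1 s2 k * x ^ k / fact k)"
  shows "T s0 s1 s2 k = A * (C1 * p ^ k + C2 * q ^ k + C3 * r ^ k)"
proof -
  define f where "f = (\<lambda>x. C1 * exp (p * x) + C2 * exp (q * x) + C3 * exp (r * x))"
  define F where "F = fps_const C1 * fps_exp p + fps_const C2 * fps_exp q + fps_const C3 * fps_exp r"
  have "f has_fps_expansion F"
    unfolding f_def F_def by (intro fps_expansion_intros)
  moreover have "f has_fps_expansion fps_const (1 / A) * exp_gf (T s0 s1 s2)"
    unfolding f_def egf by (intro fps_expansion_intros has_fps_expansion_T)
  ultimately have "F $ k = (fps_const (1 / A) * exp_gf (T s0 s1 s2)) $ k"
    by (simp only: fps_nth_fps_expansion)
  then have "(C1 * p ^ k + C2 * q ^ k + C3 * r ^ k) / fact k = T s0 s1 s2 k / A / fact k"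
    by (simp add: F_def add_divide_distrib)
  then show ?thesis
    using assms(1) by (simp add: eq_divide_eq mult.commute)
qed

theorem theorem10:
  fixes \<alpha> \<beta> \<gamma> c1 c2 c3 :: complex
    and A s0 s1 s2 :: "nat \<Rightarrow> complex"
    and m n :: nat
  assumes roots: "{x::complex. x ^ 3 - x ^ 2 - x - 1 = 0} = {\<alpha>, \<beta>, \<gamma>}"
    and dist: "\<alpha> \<noteq> \<beta>" "\<alpha> \<noteq> \<gamma>" "\<beta> \<noteq> \<gamma>"
    and c1: "c1 = \<alpha> / ((\<alpha> - \<beta>) * (\<alpha> - \<gamma>))"
    and c2: "c2 = \<beta> / ((\<beta> - \<alpha>) * (\<beta> - \<gamma>))"
    and c3: "c3 = \<gamma> / ((\<gamma> - \<alpha>) * (\<gamma> - \<beta>))"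
    and A_nonzero: "\<And>N. N \<ge> 1 \<Longrightarrow> A N \<noteq> 0"
    and egf: "\<And>N x. N \<ge> 1 \<Longrightarrow>
      c1 ^ N * exp (\<alpha> * x) + c2 ^ N * exp (\<beta> * x) + c3 ^ N * exp (\<gamma> * x)
      = 1 / A N * (\<Sum>k. T (s0 N) (s1 N) (s2 N) k * x ^ k / fact k)"
    and n: "n \<ge> 1"
  shows
    "let U = T (s0 n) (s1 n) (s2 n);
         V = (\<lambda>j. T (s0 (j * n)) (s1 (j * n)) (s2 (j * n)))
     in
       1 / A n ^ 5 *
         (\<Sum>(k1, k2, k3, k4, k5) \<in> {(k1, k2, k3, k4, k5). k1 + k2 + k3 + k4 + k5 = m}.
            multinomial m [k1, k2, k3, k4, k5] * U k1 * U k2 * U k3 * U k4 * U k5)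
       = - (14 * 5 ^ m / A (5 * n)) * V 5 m
         + 5 / (44 ^ n * A (2 * n)) * (\<Sum>k = 0..m. of_nat (m choose k) * 2 ^ k * V 2 k)
         + 15 / (44 ^ n * A n ^ 2) *
             (\<Sum>(k1, k2, k3) \<in> {(k1, k2, k3). k1 + k2 + k3 = m}.
                multinomial m [k1, k2, k3] * U k1 * U k2)
         + 5 / (A (4 * n) * A n) *
             (\<Sum>k = 0..m. of_nat (m choose k) * 4 ^ k * V 4 k * U (m - k))
         + 10 / (A (3 * n) * A (2 * n)) *
             (\<Sum>k = 0..m. of_nat (m choose k) * 3 ^ k * 2 ^ (m - k) * V 3 k * V 2 (m - k))"
proof -
  define U where "U = T (s0 n) (s1 n) (s2 n)"
  define V where "V = (\<lambda>j. T (s0 (j * n)) (s1 (j * n)) (s2 (j * n)))"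
  define a where "a = fps_const (c1 ^ n) * fps_exp \<alpha>"
  define b where "b = fps_const (c2 ^ n) * fps_exp \<beta>"
  define c where "c = fps_const (c3 ^ n) * fps_exp \<gamma>"
  \<comment> \<open>The factor \<open>of_nat j ^ k\<close> encodes the substitution of
    \<open>j x\<close> for \<open>x\<close>.\<close>
  define W where "W = (\<lambda>j. exp_gf (\<lambda>k. of_nat j ^ k * V j k))"
  have "x ^ 3 - x ^ 2 - x - 1 = 0" if "x \<in> {\<alpha>, \<beta>, \<gamma>}" for x
    using that roots by blast
  then have vieta: "\<alpha> + \<beta> + \<gamma> = 1" "\<alpha> * \<beta> + \<alpha> * \<gamma> + \<beta> * \<gamma> = - 1" "\<alpha> * \<beta> * \<gamma> = 1"
    using tribonacci_vieta[of \<alpha> \<beta> \<gamma>] dist by simp_all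
  \<comment> \<open>The numerators multiply to \<alpha>\<beta>\<gamma> = 1 and the denominators to
    44.\<close>
  have "c1 * c2 * c3 = 1 / 44"
    using tribonacci_discriminant[OF vieta] vieta(3) by (simp add: c1 c2 c3)
  then have "c1 ^ n * c2 ^ n * c3 ^ n = 1 / 44 ^ n"
    by (metis power_mult_distrib power_one_over)
  moreover have "fps_exp \<alpha> * fps_exp \<beta> * fps_exp \<gamma> = fps_exp 1"
    by (simp flip: fps_exp_add_mult add: vieta(1))
  moreover have "a * b * c = fps_const (c1 ^ n * c2 ^ n * c3 ^ n) * (fps_exp \<alpha> * fps_exp \<beta> * fps_exp \<gamma>)"
    by (simp add: a_def b_def c_def ac_simps flip: fps_const_mult)
  ultimately have abc: "a * b * c = fps_const (1 / 44 ^ n) * fps_exp 1"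
    by simp
  \<comment> \<open>The j-th power of \<open>fps_exp w\<close> is \<open>fps_exp\<close> of
    \<open>j w\<close>, which accounts for the factor \<open>of_nat j ^ k\<close> in
    \<open>W\<close>.\<close>
  have pow: "(fps_const (z ^ n) * fps_exp w) ^ j $ k = z ^ (j * n) * (of_nat j ^ k * w ^ k) / fact k"
    for z w :: complex and j k
    by (simp add: power_mult_distrib fps_exp_power_mult fps_const_power mult.commute flip: power_mult)
  have p: "a ^ j + b ^ j + c ^ j = fps_const (1 / A (j * n)) * W j" if "j \<ge> 1" for j
  proof (rule fps_ext)
    fix k
    have jn: "j * n \<ge> 1" using that n by simp
    have "V j k = A (j * n) * (c1 ^ (j * n) * \<alpha> ^ k + c2 ^ (j * n) * \<beta> ^ k + c3 ^ (j * n) * \<gamma> ^ k)"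
      unfolding V_def by (rule T_eq_if_egf_eq[OF A_nonzero[OF jn] egf[OF jn]])
    then show "(a ^ j + b ^ j + c ^ j) $ k = (fps_const (1 / A (j * n)) * W j) $ k"
      unfolding a_def b_def c_def W_def fps_add_nth pow
      using A_nonzero[OF jn] by (simp add: field_simps)
  qed
  have W1: "W 1 = exp_gf U"
    by (simp add: W_def U_def V_def)
  have p1: "a + b + c = fps_const (1 / A n) * exp_gf U"
    using p[of 1] W1 by simp
  have "(fps_const (1 / A n) * exp_gf U) ^ 5 =
      - (14 * (fps_const (1 / A (5 * n)) * W 5))
      + 5 * (fps_const (1 / 44 ^ n) * fps_exp 1 * (fps_const (1 / A (2 * n)) * W 2))
      + 15 * (fps_const (1 / 44 ^ n) * fps_exp 1 * (fps_const (1 / A n) * exp_gf U)\<^sup>2)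
      + 5 * ((fps_const (1 / A (4 * n)) * W 4) * (fps_const (1 / A n) * exp_gf U))
      + 10 * ((fps_const (1 / A (3 * n)) * W 3) * (fps_const (1 / A (2 * n)) * W 2))"
    using power_sum_identity[of a b c] by (simp only: p p1 abc one_le_numeral)
  \<comment> \<open>Scalars are collected in front, so that every remaining product has a known
    coefficient formula. In the \<open>W 2\<close> term the exponential is written as
    \<open>exp_gf (\<lambda>_. 1)\<close>, which makes it a plain binomial sum.\<close>
  also have "\<dots> = fps_const (- 14 / A (5 * n)) * W 5
      + fps_const (5 / (44 ^ n * A (2 * n))) * (W 2 * exp_gf (\<lambda>_. 1))
      + fps_const (15 / (44 ^ n * A n ^ 2)) * ((exp_gf U)\<^sup>2 * fps_exp 1)
      + fps_const (5 / (A (4 * n) * A n)) * (W 4 * exp_gf U)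
      + fps_const (10 / (A (3 * n) * A (2 * n))) * (W 3 * W 2)"
  proof -
    have const:
      "fps_const (- 14 / A (5 * n)) = - (14 * fps_const (1 / A (5 * n)))"
      "fps_const (5 / (44 ^ n * A (2 * n))) = 5 * (fps_const (1 / 44 ^ n) * fps_const (1 / A (2 * n)))"
      "fps_const (15 / (44 ^ n * A n ^ 2)) = 15 * (fps_const (1 / 44 ^ n) * (fps_const (1 / A n))\<^sup>2)"
      "fps_const (5 / (A (4 * n) * A n)) = 5 * (fps_const (1 / A (4 * n)) * fps_const (1 / A n))"
      "fps_const (10 / (A (3 * n) * A (2 * n))) =
        10 * (fps_const (1 / A (3 * n)) * fps_const (1 / A (2 * n)))"
      by (simp_all add: numeral_fps_const fps_const_power power_one_over)
    show ?thesis
      unfolding const exp_gf_one by (simp only: power_mult_distrib mult_ac mult_minus_left mult_minus_right)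
  qed
  also have "(fps_const (1 / A n) * exp_gf U) ^ 5 = fps_const (1 / A n ^ 5) * exp_gf U ^ 5"
    by (simp add: power_mult_distrib fps_const_power power_one_over)
  finally have "(fps_const (1 / A n ^ 5) * exp_gf U ^ 5) $ m * fact m =
      (fps_const (- 14 / A (5 * n)) * W 5
      + fps_const (5 / (44 ^ n * A (2 * n))) * (W 2 * exp_gf (\<lambda>_. 1))
      + fps_const (15 / (44 ^ n * A n ^ 2)) * ((exp_gf U)\<^sup>2 * fps_exp 1)
      + fps_const (5 / (A (4 * n) * A n)) * (W 4 * exp_gf U)
      + fps_const (10 / (A (3 * n) * A (2 * n))) * (W 3 * W 2)) $ m * fact m"
    by simp
  \<comment> \<open>Each coefficient formula ends in a division by \<open>fact m\<close>, which the
    multiplication by \<open>fact m\<close> cancels term by term.\<close>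
  moreover have "x * (y / fact m) * fact m = x * y" for x y :: complex
    by simp
  ultimately show ?thesis
    unfolding Let_def U_def[symmetric] V_def[symmetric] W_def
    by (simp only: fps_add_nth fps_mult_left_const_nth exp_gf_mult_nth exp_gf_power5_nth
        exp_gf_square_exp_nth exp_gf_nth distrib_right) (simp add: mult_ac)
qed

end
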